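(* Let $f:\mathbb{R}^m\to\mathbb{R}\cup\{+\infty\}$ be lower semicontinuous, convex, G\^ateaux differentiable (at every point of $\mathrm{dom}(f)$) and bounded below, let $x_0\in\mathrm{dom}(f)$, and let $\Omega:=\{x\in\mathbb{R}^m: f(x)\le f(x_0)\}$. Suppose that $\Omega$ is bounded and $\Omega\subset\mathrm{int}(\mathrm{dom}(f))$. Let $\{x_n\}$ be generated by Algorithm NSDM started at $x_0$. Then there exists a subsequence $\{x_{n_k}\}$ of $\{x_n\}$ that converges to a point $\bar x\in\Omega$ that minimizes $f(z)$ over $z\in\mathbb{R}^m$.
   Context: $\mathbb{R}^m$ carries the Euclidean inner product and norm; $\mathrm{dom}(f):=\{y: f(y)<+\infty\}$; $\mathrm{int}(A)$ is the interior of $A$. $f$ is G\^ateaux differentiable at $x\in\mathrm{dom}(f)$ iff there exists $\xi\in\mathbb{R}^m$ such that $\lim_{t\downarrow0}\frac{f(x+th)-f(x)}{t}=\langle\xi,h\rangle$ for all $h\in\mathbb{R}^m$. For the convex function $f$ and $x\in\mathrm{dom}(f)$, $\partial f(x)=\{\zeta\in\mathbb{R}^m:\langle\zeta,y-x\rangle\le f(y)-f(x)\ \ \forall y\in\mathbb{R}^m\}$ is the subdifferential of convex analysis (for convex lower semicontinuous $f$ the proximal subdifferential $\partial_p f(x)$ coincides with it). Algorithm NSDM (for convex $f$). Start from $x_0$. For $n=1,2,\dots$: choose any $v_{n-1}\in\partial f(x_{n-1})$. If $v_{n-1}=0$, terminate. Otherwise set $u_{n-1}:=-v_{n-1}/\|v_{n-1}\|$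 and $x_n:=x_{n-1}+\varepsilon_{n-1}u_{n-1}$, where $\varepsilon_{n-1}\ge 0$ is chosen such that $f(x_{n-1}+\varepsilon_{n-1}u_{n-1})=\min_{t\ge0}f(x_{n-1}+tu_{n-1})$. Convention: if the algorithm terminates at $x_{n-1}$, the sequence is continued by $x_k:=x_{n-1}$ for all $k\ge n$. *)

theory Defs
  imports "HOL-Analysis.Analysis"
begin

definition eff_dom :: "('a \<Rightarrow> ereal) \<Rightarrow> 'a set" where
  "eff_dom f = {y. f y < \<infinity>}"

definition lower_semicontinuous :: "('a::topological_space \<Rightarrow> ereal) \<Rightarrow> bool" where
  "lower_semicontinuous f \<longleftrightarrow> (\<forall>x. f x \<le> Liminf (at x) f)"

(* Extended-real analogue of convex_on UNIV.  It is meant for functions that never take the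
   value -\<infinity>, so that no sum \<infinity> + (-\<infinity>) arises; in ereal, 0 * \<infinity> = 0, so the cases
   u = 0 and v = 0 are trivially true. *)
definition ereal_convex :: "('a::real_vector \<Rightarrow> ereal) \<Rightarrow> bool" where
  "ereal_convex f \<longleftrightarrow>
     (\<forall>x y. \<forall>u\<ge>0. \<forall>v\<ge>0. u + v = 1 \<longrightarrow>
        f (u *\<^sub>R x + v *\<^sub>R y) \<le> ereal u * f x + ereal v * f y)"

definition gateaux_differentiable_at :: "('a::real_inner \<Rightarrow> ereal) \<Rightarrow> 'a \<Rightarrow> bool" where
  "gateaux_differentiable_at f x \<longleftrightarrow>
     x \<in> eff_dom f \<and>
     (\<exists>\<xi>. \<forall>h. ((\<lambda>t. (f (x + t *\<^sub>R h) - f x) / ereal t) \<longlongrightarrow> ereal (\<xi> \<bullet> h)) (at_right 0))"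

(* Empty outside the effective domain. *)
definition subdifferential :: "('a::real_inner \<Rightarrow> ereal) \<Rightarrow> 'a \<Rightarrow> 'a set" where
  "subdifferential f x = {\<zeta>. x \<in> eff_dom f \<and> (\<forall>y. ereal (\<zeta> \<bullet> (y - x)) \<le> f y - f x)}"

(* x is a sequence of iterates of the algorithm started at x0, with chosen subgradients v and
   step lengths \<epsilon>.  The algorithm is still running at stage n iff no earlier subgradient
   vanished; once it has stopped, x is constant and the later entries of v and \<epsilon> are
   irrelevant. *)
definition NSDM_run ::
  "('a::real_inner \<Rightarrow> ereal) \<Rightarrow> 'a \<Rightarrow> (nat \<Rightarrow> 'a) \<Rightarrow> (nat \<Rightarrow> 'a) \<Rightarrow> (nat \<Rightarrow> real) \<Rightarrow> bool" where
  "NSDM_run f x0 x v \<epsilon> \<longleftrightarrow>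
     x 0 = x0 \<and>
     (\<forall>n. (\<forall>j<n. v j \<noteq> 0) \<longrightarrow>
        v n \<in> subdifferential f (x n) \<and>
        (if v n = 0 then \<forall>k>n. x k = x n
         else let u = - (v n /\<^sub>R norm (v n)) in
           is_arg_min (\<lambda>t. f (x n + t *\<^sub>R u)) (\<lambda>t. 0 \<le> t) (\<epsilon> n) \<and>
           x (Suc n) = x n + \<epsilon> n *\<^sub>R u))"

end

theory Submission
  imports Defs
begin

text \<open>
  The iterates stay in the compact sublevel set \<open>\<Omega>\<close>, and the subgradients are bounded near any
  point of the interior of the domain, so along a subsequence \<open>x\<close> and \<open>v\<close> converge to some
  \<open>xbar\<close> and \<open>w \<in> \<partial>f(xbar)\<close>. If \<open>w \<noteq> 0\<close>, then Gateaux differentiability identifies \<open>w\<close> with the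
  gradient, so \<open>f\<close> strictly decreases from \<open>xbar\<close> along \<open>-w\<close>. By continuity the exact line search
  at late iterates of the subsequence would then reach values below \<open>f xbar\<close>, which is the limit
  of the decreasing values \<open>f (x n)\<close>, a contradiction. Hence \<open>0 \<in> \<partial>f(xbar)\<close>.
\<close>

text \<open>The \<open>Liminf\<close> over the punctured filter \<open>at y\<close> only controls
  points other than \<open>y\<close>; the centre itself satisfies \<open>c < f y\<close> by
  assumption, so the strict superlevel set is open.\<close>

lemma closed_sublevel:
  assumes "lower_semicontinuous f"
  shows "closed {y. f y \<le> (c::ereal)}"
proof -
  have "\<exists>T. open T \<and> y \<in> T \<and> T \<subseteq> {y. c < f y}" if "c < f y" for y
  proof -
    have "c < Liminf (at y) f"
      using assms that unfolding lower_semicontinuous_def by (meson less_le_trans)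
    then have "\<forall>\<^sub>F z in at y. c < f z"
      by (rule less_LiminfD)
    then obtain T where "open T" "y \<in> T" "\<forall>z\<in>T. z \<noteq> y \<longrightarrow> c < f z"
      unfolding eventually_at_topological by blast
    with that show ?thesis
      by (intro exI[of _ T]) auto
  qed
  then have "open {y. c < f y}"
    by (subst open_subopen) blast
  then show ?thesis
    by (simp add: closed_def Collect_neg_eq[symmetric] not_le)
qed

section \<open>Passage from extended real to real-valued convexity\<close>

lemma ereal_eq_on_eff_dom:
  assumes "\<And>y. f y \<noteq> -\<infinity>" "y \<in> eff_dom f"
  shows "f y = ereal (real_of_ereal (f y))"
  using assms by (cases "f y") (auto simp: eff_dom_def)

lemma ereal_combination_on_eff_dom:
  assumes "\<And>y. f y \<noteq> -\<infinity>" "a \<in> eff_dom f" "b \<in> eff_dom f"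
  shows "ereal u * f a + ereal v * f b = ereal (u * real_of_ereal (f a) + v * real_of_ereal (f b))"
  using assms(1)[of a] assms(1)[of b] assms(2,3)
  by (cases "f a"; cases "f b") (auto simp: eff_dom_def)

lemma convex_eff_dom:
  assumes "ereal_convex f" "\<And>y. f y \<noteq> -\<infinity>"
  shows "convex (eff_dom f)"
proof (rule convexI)
  fix a b :: 'a and u v :: real
  assume *: "a \<in> eff_dom f" "b \<in> eff_dom f" "0 \<le> u" "0 \<le> v" "u + v = 1"
  then have "f (u *\<^sub>R a + v *\<^sub>R b) \<le> ereal u * f a + ereal v * f b"
    using assms(1) unfolding ereal_convex_def by blast
  also have "\<dots> = ereal (u * real_of_ereal (f a) + v * real_of_ereal (f b))"
    by (rule ereal_combination_on_eff_dom[OF assms(2) *(1,2)])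
  finally show "u *\<^sub>R a + v *\<^sub>R b \<in> eff_dom f"
    by (auto simp: eff_dom_def)
qed

lemma convex_on_real_of_ereal:
  assumes "ereal_convex f" "\<And>y. f y \<noteq> -\<infinity>"
  shows "convex_on (eff_dom f) (\<lambda>y. real_of_ereal (f y))"
proof -
  have "real_of_ereal (f (u *\<^sub>R a + v *\<^sub>R b)) \<le> u * real_of_ereal (f a) + v * real_of_ereal (f b)"
    if *: "a \<in> eff_dom f" "b \<in> eff_dom f" "0 \<le> u" "0 \<le> v" "u + v = 1" for a b u v
  proof -
    have "u *\<^sub>R a + v *\<^sub>R b \<in> eff_dom f"
      using convex_eff_dom[OF assms] * by (rule convexD)
    then have "ereal (real_of_ereal (f (u *\<^sub>R a + v *\<^sub>R b))) = f (u *\<^sub>R a + v *\<^sub>R b)"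
      by (rule ereal_eq_on_eff_dom[OF assms(2), symmetric])
    also have "\<dots> \<le> ereal u * f a + ereal v * f b"
      using assms(1) * unfolding ereal_convex_def by blast
    also have "\<dots> = ereal (u * real_of_ereal (f a) + v * real_of_ereal (f b))"
      by (rule ereal_combination_on_eff_dom[OF assms(2) *(1,2)])
    finally show ?thesis by simp
  qed
  then show ?thesis
    using convex_eff_dom[OF assms] by (auto simp: convex_on_def)
qed

text \<open>A finite convex function on an open convex set in finite dimension is continuous. This
  is what allows limits of values and of subgradient inequalities below.\<close>

lemma continuous_on_interior_eff_dom:
  fixes f :: "'a::euclidean_space \<Rightarrow> ereal"
  assumes "ereal_convex f" "\<And>y. f y \<noteq> -\<infinity>"
  shows "continuous_on (interior (eff_dom f)) (\<lambda>y. real_of_ereal (f y))"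
proof (rule convex_on_continuous)
  show "convex_on (interior (eff_dom f)) (\<lambda>y. real_of_ereal (f y))"
    using convex_on_real_of_ereal[OF assms] interior_subset convex_interior[OF convex_eff_dom[OF assms]]
    by (rule convex_on_subset)
qed simp

section \<open>Subgradients and descent directions\<close>

lemma subdifferential_zero_minimizer:
  assumes "0 \<in> subdifferential f x" "\<And>y. f y \<noteq> -\<infinity>"
  shows "f x \<le> f z"
proof -
  have "x \<in> eff_dom f" "0 \<le> f z - f x"
    using assms(1) by (auto simp: subdifferential_def zero_ereal_def)
  then show ?thesis
    using assms(2)[of x] by (cases "f x"; cases "f z") (auto simp: eff_dom_def)
qed

lemma subdifferential_real:
  assumes "w \<in> subdifferential f x" "y \<in> eff_dom f" "\<And>y. f y \<noteq> -\<infinity>"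
  shows "w \<bullet> (y - x) \<le> real_of_ereal (f y) - real_of_ereal (f x)"
proof -
  have "x \<in> eff_dom f" "ereal (w \<bullet> (y - x)) \<le> f y - f x"
    using assms(1) by (auto simp: subdifferential_def)
  then show ?thesis
    using assms(2) assms(3)[of x] assms(3)[of y]
    by (cases "f x"; cases "f y") (auto simp: eff_dom_def)
qed

text \<open>Off the effective domain the right-hand side is \<open>\<infinity>\<close>, so only
  finite values have to be tested.\<close>

lemma subdifferentialI_real:
  assumes "x \<in> eff_dom f" "\<And>y. f y \<noteq> -\<infinity>"
    and "\<And>y. y \<in> eff_dom f \<Longrightarrow> w \<bullet> (y - x) \<le> real_of_ereal (f y) - real_of_ereal (f x)"
  shows "w \<in> subdifferential f x"
proof -
  have "ereal (w \<bullet> (y - x)) \<le> f y - f x" for y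
  proof (cases "y \<in> eff_dom f")
    case True
    then show ?thesis
      using assms(1) assms(2)[of x] assms(2)[of y] assms(3)[OF True]
      by (cases "f x"; cases "f y") (auto simp: eff_dom_def)
  next
    case False
    then have "f y = \<infinity>" by (simp add: eff_dom_def)
    then show ?thesis
      using assms(1) assms(2)[of x] by (cases "f x") (auto simp: eff_dom_def)
  qed
  with assms(1) show ?thesis by (simp add: subdifferential_def)
qed

text \<open>Dividing the subgradient inequality by \<open>t\<close> and letting \<open>t\<close>
  decrease to 0 gives \<open>w \<bullet> h \<le> \<xi> \<bullet> h\<close> for every
  \<open>h\<close>, and \<open>h = w - \<xi>\<close> forces \<open>\<xi> = w\<close>. The derivative
  along \<open>-w / norm w\<close> is then \<open>-norm w\<close>. For a nonsmooth convex function a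
  negative subgradient need not be a descent direction.\<close>

lemma subgradient_descent:
  fixes f :: "'a::real_inner \<Rightarrow> ereal"
  assumes w: "w \<in> subdifferential f x" "w \<noteq> 0"
    and G: "gateaux_differentiable_at f x"
    and fin: "\<And>y. f y \<noteq> -\<infinity>"
  shows "\<forall>\<^sub>F t in at_right 0. f (x - t *\<^sub>R (w /\<^sub>R norm w)) < f x"
proof -
  have x: "x \<in> eff_dom f"
    using G by (simp add: gateaux_differentiable_at_def)
  obtain a where a: "f x = ereal a"
    using ereal_eq_on_eff_dom[OF fin x] by blast
  obtain \<xi> where \<xi>: "\<And>h. ((\<lambda>t. (f (x + t *\<^sub>R h) - f x) / ereal t) \<longlongrightarrow> ereal (\<xi> \<bullet> h)) (at_right 0)"
    using G by (auto simp: gateaux_differentiable_at_def)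
  have le: "w \<bullet> h \<le> \<xi> \<bullet> h" for h
  proof -
    have "ereal (w \<bullet> h) \<le> (f (x + t *\<^sub>R h) - f x) / ereal t" if "t > 0" for t
    proof -
      have "ereal (w \<bullet> (x + t *\<^sub>R h - x)) \<le> f (x + t *\<^sub>R h) - f x"
        using w(1) unfolding subdifferential_def by blast
      with that show ?thesis
        by (simp add: ereal_le_divide_pos inner_scaleR_right mult.commute)
    qed
    then have "\<forall>\<^sub>F t in at_right 0. ereal (w \<bullet> h) \<le> (f (x + t *\<^sub>R h) - f x) / ereal t"
      by (rule eventually_mono[OF eventually_at_right_less])
    then have "ereal (w \<bullet> h) \<le> ereal (\<xi> \<bullet> h)"
      by (rule tendsto_lowerbound[OF \<xi>]) simp
    then show ?thesis by simp
  qed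
  have "(w - \<xi>) \<bullet> (w - \<xi>) \<le> 0"
    using le[of "w - \<xi>"] by (simp add: inner_diff_left)
  then have "(w - \<xi>) \<bullet> (w - \<xi>) = 0"
    by (rule antisym) simp
  then have [simp]: "\<xi> = w" by simp
  define u where "u = - (w /\<^sub>R norm w)"
  have "w \<bullet> u = - norm w"
    using w(2) by (simp add: u_def dot_square_norm power2_eq_square)
  then have "ereal (\<xi> \<bullet> u) < 0"
    using w(2) by simp
  then have "\<forall>\<^sub>F t in at_right 0. (f (x + t *\<^sub>R u) - f x) / ereal t < 0"
    using order_tendstoD(2)[OF \<xi>] by blast
  moreover have "\<forall>\<^sub>F t::real in at_right 0. 0 < t"
    by (rule eventually_at_right_less)
  ultimately show ?thesis
  proof eventually_elim
    case (elim t)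
    then have "f (x + t *\<^sub>R u) < f x"
      using a by (cases "f (x + t *\<^sub>R u)") (auto simp: divide_less_0_iff)
    then show ?case by (simp add: u_def)
  qed
qed

theorem theorem3p4:
  fixes f :: "real ^ 'm \<Rightarrow> ereal"
    and x0 :: "real ^ 'm"
    and \<Omega> :: "(real ^ 'm) set"
    and x v :: "nat \<Rightarrow> real ^ 'm"
    and \<epsilon> :: "nat \<Rightarrow> real"
  assumes no_minf: "\<And>y. f y \<noteq> -\<infinity>"
    and lsc: "lower_semicontinuous f"
    and convex: "ereal_convex f"
    and gateaux: "\<And>y. y \<in> eff_dom f \<Longrightarrow> gateaux_differentiable_at f y"
    and bdd_below: "\<exists>c::real. \<forall>y. ereal c \<le> f y"
    and x0: "x0 \<in> eff_dom f"
    and \<Omega>: "\<Omega> = {y. f y \<le> f x0}"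
    and bounded: "bounded \<Omega>"
    and interior: "\<Omega> \<subseteq> interior (eff_dom f)"
    and run: "NSDM_run f x0 x v \<epsilon>"
  shows "\<exists>r xbar. strict_mono r \<and> (x \<circ> r) \<longlonglongrightarrow> xbar \<and> xbar \<in> \<Omega> \<and> (\<forall>z. f xbar \<le> f z)"
proof -
  \<comment> \<open>Where \<open>f\<close> is infinite, \<open>g\<close> has the default value 0, so
    every comparison of \<open>g\<close> values first needs membership in
    \<open>eff_dom f\<close>.\<close>
  define g where "g y = real_of_ereal (f y)" for y
  define S where "S = interior (eff_dom f)"
  have S: "open S" "S \<subseteq> eff_dom f" "\<Omega> \<subseteq> S"
    using interior interior_subset by (auto simp: S_def)
  have fg: "f y = ereal (g y)" if "y \<in> eff_dom f" for y
    using ereal_eq_on_eff_dom[OF no_minf that] by (simp add: g_def)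
  have cont: "isCont g y" if "y \<in> S" for y
    using continuous_on_interior_eff_dom[OF convex no_minf] that S(1)
    by (simp add: g_def[abs_def] S_def continuous_on_eq_continuous_at)
  show ?thesis
  proof (cases "\<exists>n. v n = 0")
    case True
    \<comment> \<open>The least such index is needed because the clause of \<open>NSDM_run\<close>
      at stage \<open>n\<close> only speaks while all earlier subgradients are nonzero. From there
      on the iterates are constant.\<close>
    then obtain n where n: "v n = 0" "\<forall>j<n. v j \<noteq> 0"
      using exists_least_iff[of "\<lambda>n. v n = 0"] by blast
    have sub: "v n \<in> subdifferential f (x n)" and stop: "\<forall>k>n. x k = x n"
      using run[unfolded NSDM_run_def, THEN conjunct2, THEN spec, of n] n by simp_all
    have min: "f (x n) \<le> f z" for z
      using sub n(1) no_minf by (simp add: subdifferential_zero_minimizer)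
    have "x \<circ> (\<lambda>k. k + n) = (\<lambda>k. x n)"
    proof
      fix k show "(x \<circ> (\<lambda>k. k + n)) k = x n"
        using stop by (cases k) auto
    qed
    then have "(x \<circ> (\<lambda>k. k + n)) \<longlonglongrightarrow> x n"
      by simp
    moreover have "strict_mono (\<lambda>k. k + n)"
      by (simp add: strict_mono_def)
    ultimately show ?thesis
      using min \<Omega> by blast
  next
    case False
    then have v0: "v n \<noteq> 0" for n by blast
    define u where "u n = - (v n /\<^sub>R norm (v n))" for n
    have sub: "v n \<in> subdifferential f (x n)"
      and am: "is_arg_min (\<lambda>t. f (x n + t *\<^sub>R u n)) (\<lambda>t. 0 \<le> t) (\<epsilon> n)"
      and step: "x (Suc n) = x n + \<epsilon> n *\<^sub>R u n" for n
      using run v0 unfolding NSDM_run_def u_def Let_def by auto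
    \<comment> \<open>Used twice: \<open>t = 0\<close> makes the values decrease, and a fixed
      positive \<open>t\<close> yields the final contradiction.\<close>
    have search: "f (x (Suc n)) \<le> f (x n + t *\<^sub>R u n)" if "0 \<le> t" for n t
      using am[of n] that by (auto simp: is_arg_min_def step not_less)
    have dec: "f (x n) \<le> f (x m)" if "m \<le> n" for m n
    proof (rule lift_Suc_antimono_le[of "\<lambda>n. f (x n)", OF _ that])
      show "f (x (Suc k)) \<le> f (x k)" for k
        using search[of 0 k] by simp
    qed
    have x\<Omega>: "x n \<in> \<Omega>" for n
      using dec[of 0 n] run by (simp add: \<Omega> NSDM_run_def)
    then have xdom: "x n \<in> eff_dom f" for n
      using S by blast
    have "compact \<Omega>"
      using closed_sublevel[OF lsc] bounded by (simp add: \<Omega> compact_eq_bounded_closed)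
    then obtain xbar r1 where xbar: "xbar \<in> \<Omega>" and r1: "strict_mono r1" "(x \<circ> r1) \<longlonglongrightarrow> xbar"
      using x\<Omega> unfolding compact_def by meson
    have xbarS: "xbar \<in> S" and xbardom: "xbar \<in> eff_dom f"
      using xbar S by auto
    obtain c where c: "\<And>y. ereal c \<le> f y"
      using bdd_below by blast
    have gc: "c \<le> g y" if "y \<in> eff_dom f" for y
      using c[of y] fg[OF that] by simp
    have "\<forall>\<^sub>F y in nhds xbar. y \<in> S \<and> g y < g xbar + 1"
    proof (rule eventually_conj)
      show "\<forall>\<^sub>F y in nhds xbar. y \<in> S"
        using S(1) xbarS by (rule eventually_nhds_in_open)
      show "\<forall>\<^sub>F y in nhds xbar. g y < g xbar + 1"
        using cont[OF xbarS] by (intro order_tendstoD(2)) (auto simp: isCont_def tendsto_at_iff_tendsto_nhds)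
    qed
    then obtain d where d: "d > 0" "\<And>y. dist y xbar < d \<Longrightarrow> y \<in> S \<and> g y < g xbar + 1"
      unfolding eventually_nhds_metric by blast
    \<comment> \<open>On the ball of radius \<open>d\<close>, \<open>g\<close> lies between
      \<open>c\<close> and \<open>g xbar + 1\<close>, while a move of length \<open>d / 2\<close>
      along a subgradient raises \<open>g\<close> by at least \<open>d / 2\<close> times its
      norm.\<close>
    define B where "B = (g xbar + 1 - c) / (d / 2)"
    have "\<forall>\<^sub>F k in sequentially. dist (x (r1 k)) xbar < d / 2"
      using tendstoD[OF r1(2), of "d / 2"] d(1) by (simp only: o_def half_gt_zero)
    then obtain N where N: "\<And>k. k \<ge> N \<Longrightarrow> dist (x (r1 k)) xbar < d / 2"
      unfolding eventually_sequentially by blast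
    have "norm (v (r1 k)) \<le> B" if "k \<ge> N" for k
    proof -
      let ?n = "r1 k"
      \<comment> \<open>Since \<open>u\<close> points against \<open>v\<close>, this moves along
        \<open>+v\<close>, and the two halves of \<open>d\<close> keep the point in the ball around
        \<open>xbar\<close>.\<close>
      let ?y = "x ?n - (d / 2) *\<^sub>R u ?n"
      have "norm (u ?n) = 1"
        using v0 by (simp add: u_def)
      then have "dist ?y (x ?n) = d / 2"
        using d(1) by (simp add: dist_norm)
      then have "dist ?y xbar < d"
        using dist_triangle[of ?y xbar "x ?n"] N[OF that] by simp
      then have y: "?y \<in> eff_dom f" "g ?y < g xbar + 1"
        using d(2) S by blast+
      have "v ?n \<bullet> (?y - x ?n) \<le> g ?y - g (x ?n)"
        unfolding g_def by (rule subdifferential_real[OF sub y(1) no_minf])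
      moreover have "v ?n \<bullet> (?y - x ?n) = d / 2 * norm (v ?n)"
        using v0[of ?n] by (simp add: u_def dot_square_norm power2_eq_square)
      ultimately have "d / 2 * norm (v ?n) \<le> g xbar + 1 - c"
        using y(2) gc[OF xdom[of ?n]] by linarith
      then show ?thesis
        using d(1) by (simp add: B_def field_simps)
    qed
    then have "\<forall>k. v (r1 (k + N)) \<in> cball 0 B"
      by simp
    then obtain w r2 where r2: "strict_mono r2" "((\<lambda>k. v (r1 (k + N))) \<circ> r2) \<longlonglongrightarrow> w"
      using compact_cball[of 0 B] unfolding compact_def by meson
    define r where "r k = r1 (r2 k + N)" for k
    have r: "strict_mono r"
      using r1(1) r2(1) by (simp add: r_def strict_mono_def)
    have vlim: "(\<lambda>k. v (r k)) \<longlonglongrightarrow> w"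
      using r2(2) by (simp add: r_def o_def)
    have xlim: "(\<lambda>k. x (r k)) \<longlonglongrightarrow> xbar"
    proof -
      have "strict_mono (\<lambda>k. r2 k + N)"
        using r2(1) by (simp add: strict_mono_def)
      from LIMSEQ_subseq_LIMSEQ[OF r1(2) this] show ?thesis
        by (simp add: r_def o_def)
    qed
    have glim: "(\<lambda>k. g (x (r k))) \<longlonglongrightarrow> g xbar"
      using cont[OF xbarS] xlim by (rule isCont_tendsto_compose)
    \<comment> \<open>The graph of the subdifferential is closed here: for fixed \<open>y\<close>
      the inequality passes to the limit because \<open>g\<close> is continuous at
      \<open>xbar\<close>.\<close>
    have w: "w \<in> subdifferential f xbar"
    proof (rule subdifferentialI_real[OF xbardom no_minf])
      fix y assume y: "y \<in> eff_dom f"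
      have "(\<lambda>k. v (r k) \<bullet> (y - x (r k))) \<longlonglongrightarrow> w \<bullet> (y - xbar)"
        by (intro tendsto_intros vlim xlim)
      moreover have "(\<lambda>k. g y - g (x (r k))) \<longlonglongrightarrow> g y - g xbar"
        by (intro tendsto_intros glim)
      moreover have "v n \<bullet> (y - x n) \<le> g y - g (x n)" for n
        unfolding g_def by (rule subdifferential_real[OF sub y no_minf])
      ultimately show "w \<bullet> (y - xbar) \<le> real_of_ereal (f y) - real_of_ereal (f xbar)"
        unfolding g_def[symmetric] by (intro LIMSEQ_le) auto
    qed
    have "w = 0"
    proof (rule ccontr)
      assume w0: "w \<noteq> 0"
      define ub where "ub = - (w /\<^sub>R norm w)"
      have "\<forall>\<^sub>F t in at_right 0. f (xbar - t *\<^sub>R (w /\<^sub>R norm w)) < f xbar"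
        using subgradient_descent[OF w w0 gateaux[OF xbardom] no_minf] .
      \<comment> \<open>The trial point must also lie in \<open>S\<close>, so that \<open>g\<close>
        is continuous there and nearby trial points have finite values.\<close>
      moreover have "\<forall>\<^sub>F t in at_right 0. xbar + t *\<^sub>R ub \<in> S"
      proof -
        have "((\<lambda>t. xbar + t *\<^sub>R ub) \<longlongrightarrow> xbar + 0 *\<^sub>R ub) (at_right 0)"
          by (intro tendsto_intros)
        then show ?thesis
          using topological_tendstoD[of "\<lambda>t. xbar + t *\<^sub>R ub" xbar] S(1) xbarS by simp
      qed
      moreover have "\<forall>\<^sub>F t::real in at_right 0. 0 < t"
        by (rule eventually_at_right_less)
      ultimately have "\<forall>\<^sub>F t in at_right 0. 0 < t \<and> xbar + t *\<^sub>R ub \<in> S \<and> f (xbar + t *\<^sub>R ub) < f xbar"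
        by eventually_elim (simp add: ub_def)
      then obtain t where t: "0 < t" "xbar + t *\<^sub>R ub \<in> S" "f (xbar + t *\<^sub>R ub) < f xbar"
        using eventually_happens'[OF trivial_limit_at_right_real] by blast
      \<comment> \<open>Normalization is continuous away from 0, so the search directions converge
        because \<open>w\<close> is nonzero.\<close>
      have plim: "(\<lambda>k. x (r k) + t *\<^sub>R u (r k)) \<longlonglongrightarrow> xbar + t *\<^sub>R ub"
        unfolding u_def ub_def using w0 by (intro tendsto_intros xlim vlim) simp
      \<comment> \<open>Monotonicity extends the bound from the subsequence to all iterates; it is
        needed at \<open>Suc (r k)\<close>, which may lie outside the range of
        \<open>r\<close>.\<close>
      have le: "g xbar \<le> g (x n)" for n
      proof (rule LIMSEQ_le_const2[OF glim], intro exI[of _ n] allI impI)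
        fix k assume "n \<le> k"
        then have "n \<le> r k"
          using seq_suble[OF r, of k] by linarith
        then show "g (x (r k)) \<le> g (x n)"
          using dec[of n "r k"] by (simp add: fg xdom)
      qed
      have "\<forall>\<^sub>F k in sequentially. x (r k) + t *\<^sub>R u (r k) \<in> S"
        using topological_tendstoD[OF plim S(1) t(2)] .
      \<comment> \<open>The fixed step \<open>t\<close> competes in the exact line search at
        \<open>x (r k)\<close>, so its value is at least that of the next iterate, hence at least
        \<open>g xbar\<close>.\<close>
      then have "\<forall>\<^sub>F k in sequentially. g xbar \<le> g (x (r k) + t *\<^sub>R u (r k))"
      proof eventually_elim
        case (elim k)
        then have "x (r k) + t *\<^sub>R u (r k) \<in> eff_dom f"
          using S by blast
        then have "g (x (Suc (r k))) \<le> g (x (r k) + t *\<^sub>R u (r k))"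
          using search[of t "r k"] t(1) by (simp add: fg xdom)
        with le[of "Suc (r k)"] show ?case by linarith
      qed
      then have "g xbar \<le> g (xbar + t *\<^sub>R ub)"
        using tendsto_lowerbound[OF isCont_tendsto_compose[OF cont[OF t(2)] plim]] by simp
      moreover have "g (xbar + t *\<^sub>R ub) < g xbar"
        using t(2,3) S(2) by (simp add: fg xbardom subset_iff)
      ultimately show False by simp
    qed
    then have "f xbar \<le> f z" for z
      using w no_minf by (simp add: subdifferential_zero_minimizer)
    moreover have "(x \<circ> r) \<longlonglongrightarrow> xbar"
      using xlim by (simp add: o_def)
    ultimately show ?thesis
      using r xbar by blast
  qed
qed

end
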